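(* Let $A,B\in\mathbb{C}^{n\times n}$ with $A^{\mathsf H}=A$, $B^{\mathsf T}=B$, and $H=\begin{bmatrix}A&B\\-\overline{B}&-\overline{A}\end{bmatrix}$. Let $\alpha>0$, let $k_0>1$ be an integer, $\vartheta\in\{-1,1\}$, $\beta\in\mathbb{R}$ with $\vartheta\beta>0$, $\kappa\ge2$, and $\gamma=\beta\,\dfrac{\kappa^{2^{k_0}}+\vartheta}{\vartheta\kappa^{2^{k_0}}-1}$. Let $\lambda$ be an eigenvalue of $H$ that is not purely imaginary, with $\operatorname{Re}(\lambda)<0$, and put $$\delta_\lambda=\frac{\lambda+\alpha}{\lambda-\alpha},\qquad \varpi=\frac{\beta-\vartheta\gamma}{\beta\vartheta+\gamma},\qquad \nu=\vartheta\cdot\frac{\varpi+\delta_\lambda^{2^{k_0}}}{1+\varpi\,\delta_\lambda^{2^{k_0}}}.$$ Then $$|\nu|\le\max\left\{|\delta_\lambda|^{2^{k_0-2}},\ \kappa^{-2^{k_0-2}}\right\}.$$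
   Context: Here $\nu$ is the eigenvalue of the new symplectic pair produced by a double-Cayley transform (with parameters $\vartheta,\beta,\gamma$) at step $k_0$ of the doubling algorithm that corresponds to the eigenvalue $\lambda$ of $H$; $\delta_\lambda^{2^{k_0}}$ is the corresponding eigenvalue before the transform. *)

theory Defs
  imports Complex_Main "Jordan_Normal_Form.Char_Poly" "Jordan_Normal_Form.Schur_Decomposition"
begin

end

theory Submission
  imports Defs
begin

text \<open>
  Write \<open>K = \<kappa> ^ (2 ^ k0)\<close> and \<open>d = \<delta> ^ (2 ^ k0)\<close>. The choice of \<open>\<gamma>\<close> makes
  \<open>varpi = - 1 / K\<close> for both signs of \<open>\<theta>\<close>, so up to sign \<open>\<nu>\<close> is the image of \<open>d\<close> under
  the disc automorphism \<open>z \<mapsto> (z - b) / (1 - b * z)\<close> with \<open>b = 1 / K\<close>. Since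
  \<open>Re lambda < 0 < \<alpha>\<close>, the Cayley transform puts \<open>\<delta>\<close>, and hence \<open>d\<close>, inside the unit disc.
  On the circle of radius \<open>r = norm d\<close>, the automorphism has its largest modulus at \<open>- r\<close>, so
  \<open>norm \<nu> \<le> (r + b) / (1 + b * r)\<close> (lemma \<open>norm_disc_automorphism_le\<close>).

  Raising to the power \<open>2 ^ (k0 - 2)\<close> is raising to the power \<open>2 ^ k0\<close> and taking a fourth root,
  so what remains is a bound by \<open>max t s\<close> where \<open>r = t ^ 4\<close> and \<open>b = s ^ 4\<close>
  (lemma \<open>sum_fourth_powers_le_max\<close>). This cannot hold for all \<open>s\<close> and \<open>t\<close> below 1: with
  \<open>s = t\<close> close to 1 the left-hand side \<open>2 * t ^ 4 / (1 + t ^ 8)\<close> exceeds \<open>t\<close>, because its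
  derivative at 1 is 0. The assumptions \<open>\<kappa> \<ge> 2\<close> and \<open>k0 > 1\<close> exclude this by giving
  \<open>s \<le> 1 / 2\<close>. If \<open>t\<close> is also at most \<open>1 / 2\<close>, the fourth powers are so small that their
  sum does not exceed the maximum; if \<open>t\<close> is larger, the smallness of \<open>s\<close> keeps the automorphism close
  enough to the identity.
\<close>

text \<open>
  After squaring and clearing denominators, the difference of the two sides is
  \<open>2 * b * (1 - r\<^sup>2) * (1 - b\<^sup>2) * (Re z + r)\<close> with \<open>r = norm z\<close>, which is nonnegative and
  vanishes at \<open>z = - r\<close>.
\<close>
lemma norm_disc_automorphism_le:
  fixes z :: complex and b :: real
  assumes "norm z \<le> 1" "0 \<le> b" "b < 1"
  shows "norm ((z - of_real b) / (1 - of_real b * z)) \<le> (norm z + b) / (1 + b * norm z)"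
proof -
  define r where "r = norm z"
  define x where "x = Re z"
  have r: "0 \<le> r" "r \<le> 1" and xr: "- r \<le> x"
    using assms abs_Re_le_cmod[of z] by (auto simp: r_def x_def)
  have r2: "r\<^sup>2 = x\<^sup>2 + (Im z)\<^sup>2"
    by (simp add: r_def x_def cmod_power2)
  have num: "(norm (z - of_real b))\<^sup>2 = r\<^sup>2 + b\<^sup>2 - 2 * b * x"
    unfolding r2 cmod_power2 by (simp add: x_def power2_eq_square algebra_simps)
  have den: "(norm (1 - of_real b * z))\<^sup>2 = 1 + b\<^sup>2 * r\<^sup>2 - 2 * b * x"
    unfolding r2 cmod_power2 by (simp add: x_def power2_eq_square algebra_simps)
  have "b * r \<le> b"
    using r assms by (simp add: mult_left_le)
  then have br: "b * r < 1"
    using assms by simp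
  have "norm (of_real b * z) < norm (1 :: complex)"
    using br assms by (simp add: norm_mult r_def)
  then have ne: "1 - of_real b * z \<noteq> 0"
    by auto
  have "0 \<le> 2 * b * (1 - r\<^sup>2) * (1 - b\<^sup>2) * (x + r)"
    using assms r xr by (intro mult_nonneg_nonneg) (auto simp: power_le_one)
  also have "\<dots> = (r + b)\<^sup>2 * (1 + b\<^sup>2 * r\<^sup>2 - 2 * b * x) - (r\<^sup>2 + b\<^sup>2 - 2 * b * x) * (1 + b * r)\<^sup>2"
    by (simp add: power2_eq_square algebra_simps)
  finally have "(norm (z - of_real b) * (1 + b * r))\<^sup>2 \<le> ((r + b) * norm (1 - of_real b * z))\<^sup>2"
    by (simp only: power_mult_distrib num den diff_ge_0_iff_ge)
  then have "norm (z - of_real b) * (1 + b * r) \<le> (r + b) * norm (1 - of_real b * z)"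
    by (rule power2_le_imp_le) (use assms r in simp)
  moreover have "0 < 1 + b * r"
    using assms r by (simp add: add_pos_nonneg)
  ultimately have "norm (z - of_real b) \<le> (r + b) * norm (1 - of_real b * z) / (1 + b * r)"
    by (intro mult_imp_le_div_pos)
  then have "norm (z - of_real b) / norm (1 - of_real b * z) \<le> (r + b) / (1 + b * r)"
    using ne by (intro mult_imp_div_pos_le) simp_all
  then show ?thesis
    by (simp only: norm_divide r_def)
qed

text \<open>
  The interesting case is \<open>t > 1 / 2\<close>. The left-hand side increases with \<open>s\<close>, so \<open>s = 1 / 2\<close> is
  the worst case, and there the claim is \<open>1 - t ^ 5 \<le> 16 * t * (1 - t ^ 3)\<close>. Both sides vanish
  at \<open>t = 1\<close>, and dividing by \<open>1 - t\<close> leaves an inequality with ample room.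
\<close>
lemma sum_fourth_powers_le_max:
  fixes s t :: real
  assumes "0 \<le> t" "t \<le> 1" "0 \<le> s" "s \<le> 1 / 2"
  shows "(t ^ 4 + s ^ 4) / (1 + s ^ 4 * t ^ 4) \<le> max t s"
proof (cases "t \<le> 1 / 2")
  case True
  define m where "m = max t s"
  have m: "0 \<le> m" "m \<le> 1 / 2" "t \<le> m" "s \<le> m"
    using True assms by (auto simp: m_def)
  have "(t ^ 4 + s ^ 4) / (1 + s ^ 4 * t ^ 4) \<le> t ^ 4 + s ^ 4"
    using assms divide_left_mono[of 1 "1 + s ^ 4 * t ^ 4" "t ^ 4 + s ^ 4"]
    by (simp add: add_pos_nonneg)
  also have "\<dots> \<le> m ^ 4 + m ^ 4"
    using m assms by (intro add_mono power_mono) auto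
  also have "\<dots> = 2 * m ^ 3 * m"
    by (simp add: eval_nat_numeral)
  also have "\<dots> \<le> 1 * m"
    using power_mono[of m "1 / 2" 3] m by (intro mult_right_mono) (auto simp: power_divide)
  finally show ?thesis
    by (simp add: m_def)
next
  case False
  have s4: "s ^ 4 \<le> 1 / 16"
    using power_mono[of s "1 / 2" 4] assms by (simp add: power_divide)
  have "t ^ 3 + t ^ 4 \<le> 1 + 1"
    using assms by (intro add_mono power_le_one)
  moreover have "0 \<le> 7 * t + 7 * t ^ 2"
    using assms by simp
  ultimately have "1 + t + t ^ 2 + t ^ 3 + t ^ 4 \<le> 8 * (1 + t + t ^ 2)"
    unfolding distrib_left by linarith
  also have "\<dots> \<le> 16 * t * (1 + t + t ^ 2)"
    using False by (intro mult_right_mono) auto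
  finally have "(1 - t) * (1 + t + t ^ 2 + t ^ 3 + t ^ 4) \<le> (1 - t) * (16 * t * (1 + t + t ^ 2))"
    using assms by (intro mult_left_mono) auto
  then have "1 - t ^ 5 \<le> 16 * t * (1 - t ^ 3)"
    by (simp add: algebra_simps eval_nat_numeral)
  moreover have "s ^ 4 * (1 - t ^ 5) \<le> 1 / 16 * (1 - t ^ 5)"
    using s4 assms by (intro mult_right_mono) (auto simp: power_le_one)
  ultimately have "s ^ 4 * (1 - t ^ 5) \<le> t * (1 - t ^ 3)"
    by simp
  then have "t ^ 4 + s ^ 4 \<le> t * (1 + s ^ 4 * t ^ 4)"
    by (simp add: algebra_simps eval_nat_numeral)
  moreover have "0 < 1 + s ^ 4 * t ^ 4"
    using assms by (simp add: add_pos_nonneg)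
  ultimately have "(t ^ 4 + s ^ 4) / (1 + s ^ 4 * t ^ 4) \<le> t"
    by (simp add: pos_divide_le_eq)
  then show ?thesis
    by simp
qed

lemma norm_Cayley_le_1:
  fixes z :: complex and a :: real
  assumes "Re z < 0" "0 < a"
  shows "norm ((z + of_real a) / (z - of_real a)) \<le> 1"
proof -
  have "(norm (z - of_real a))\<^sup>2 - (norm (z + of_real a))\<^sup>2 = - 4 * a * Re z"
    unfolding cmod_power2 by (simp add: power2_eq_square algebra_simps)
  also have "\<dots> \<ge> 0"
    using assms by (simp add: mult_nonneg_nonpos)
  finally have "(norm (z + of_real a))\<^sup>2 \<le> (norm (z - of_real a))\<^sup>2"
    by (simp only: diff_ge_0_iff_ge)
  then have "norm (z + of_real a) \<le> norm (z - of_real a)"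
    by (rule power2_le_imp_le) simp
  then show ?thesis
    by (simp add: norm_divide divide_le_eq)
qed

text \<open>
  The parameter \<open>\<gamma>\<close> is designed so that the shift of the disc automorphism depends on \<open>K\<close>
  alone: \<open>\<beta>\<close> cancels by homogeneity and the sign \<open>\<theta>\<close> through \<open>\<theta>\<^sup>2 = 1\<close>.
\<close>
lemma double_Cayley_shift_eq:
  fixes \<beta> \<theta> K :: real
  assumes "\<theta> \<in> {-1, 1}" "\<beta> \<noteq> 0" "K > 1"
    and "\<gamma> = \<beta> * ((K + \<theta>) / (\<theta> * K - 1))"
  shows "(\<beta> - \<theta> * \<gamma>) / (\<beta> * \<theta> + \<gamma>) = - (1 / K)"
proof -
  have D: "\<theta> * K - 1 \<noteq> 0"
    using assms by auto
  have g: "\<gamma> * (\<theta> * K - 1) = \<beta> * (K + \<theta>)"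
    using D assms(4) by simp
  have "(\<beta> - \<theta> * \<gamma>) * (\<theta> * K - 1) = - 2 * \<beta>"
    using g assms(1) by (auto simp: algebra_simps)
  moreover have "(\<beta> * \<theta> + \<gamma>) * (\<theta> * K - 1) = 2 * \<beta> * K"
    using g assms(1) by (auto simp: algebra_simps)
  ultimately have "(\<beta> - \<theta> * \<gamma>) / (\<beta> * \<theta> + \<gamma>) = (- 2 * \<beta>) / (2 * \<beta> * K)"
    using D by (metis mult_divide_mult_cancel_right)
  then show ?thesis
    using assms by simp
qed

theorem theorem3p13:
  fixes n k0 :: nat
    and A B H :: "complex mat"
    and \<alpha> \<theta> \<beta> \<kappa> \<gamma> varpi :: real
    and lambda \<delta> \<nu> :: complex
  assumes "A \<in> carrier_mat n n" and "B \<in> carrier_mat n n"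
    and "mat_adjoint A = A" and "transpose_mat B = B"
    and "H = four_block_mat A B (- map_mat cnj B) (- map_mat cnj A)"
    and "\<alpha> > 0" and "k0 > 1"
    and "\<theta> \<in> {-1, 1}" and "\<theta> * \<beta> > 0" and "\<kappa> \<ge> 2"
    and "\<gamma> = \<beta> * ((\<kappa> ^ (2 ^ k0) + \<theta>) / (\<theta> * \<kappa> ^ (2 ^ k0) - 1))"
    and "eigenvalue H lambda" and "Re lambda \<noteq> 0" and "Re lambda < 0"
    and "\<delta> = (lambda + of_real \<alpha>) / (lambda - of_real \<alpha>)"
    and "varpi = (\<beta> - \<theta> * \<gamma>) / (\<beta> * \<theta> + \<gamma>)"
    and "\<nu> = of_real \<theta> *
           ((of_real varpi + \<delta> ^ (2 ^ k0)) / (1 + of_real varpi * \<delta> ^ (2 ^ k0)))"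
  shows "norm \<nu> \<le> max (norm \<delta> ^ (2 ^ (k0 - 2))) (\<kappa> powi (- (2 ^ (k0 - 2))))"
proof -
  define m :: nat where "m = 2 ^ (k0 - 2)"
  have "k0 = k0 - 2 + 2"
    using assms(7) by simp
  then have m4: "2 ^ k0 = m * 4"
    unfolding m_def by (metis power_add power2_eq_square mult_2 numeral_Bit0)
  have "1 \<le> m"
    by (simp add: m_def)
  define t where "t = norm \<delta> ^ m"
  define s where "s = 1 / \<kappa> ^ m"
  have "norm \<delta> \<le> 1"
    using norm_Cayley_le_1 assms(6,14,15) by blast
  then have t: "0 \<le> t" "t \<le> 1"
    by (auto simp: t_def power_le_one)
  have "2 \<le> \<kappa> ^ m"
    using self_le_power[of \<kappa> m] \<open>1 \<le> m\<close> assms(10) by simp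
  then have s: "0 < s" "s \<le> 1 / 2"
    by (auto simp: s_def divide_simps)
  have s4: "s ^ 4 = 1 / \<kappa> ^ (2 ^ k0)"
    by (simp add: s_def m4 power_divide power_mult)
  have t4: "t ^ 4 = norm (\<delta> ^ (2 ^ k0))"
    by (simp add: t_def m4 norm_power power_mult)
  have "1 < \<kappa> ^ (2 ^ k0)"
    using assms(10) by (intro one_less_power) auto
  then have varpi: "varpi = - (s ^ 4)"
    using double_Cayley_shift_eq[OF assms(8) _ _ assms(11)] assms(9,16) s4 by force
  have "norm \<nu> = norm ((\<delta> ^ (2 ^ k0) - of_real (s ^ 4)) / (1 - of_real (s ^ 4) * \<delta> ^ (2 ^ k0)))"
    using assms(8) by (auto simp: assms(17) varpi norm_mult norm_divide)
  also have "\<dots> \<le> (t ^ 4 + s ^ 4) / (1 + s ^ 4 * t ^ 4)"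
    unfolding t4 using s t t4[symmetric]
    by (intro norm_disc_automorphism_le) (auto simp: power_le_one power_less_one_iff)
  also have "\<dots> \<le> max t s"
    using s t by (intro sum_fourth_powers_le_max) auto
  also have "s = \<kappa> powi (- int m)"
    by (simp add: s_def power_int_minus divide_simps)
  finally show ?thesis
    by (simp add: t_def m_def)
qed

end
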